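(* Let $(X,d)$ be a metric space, let $\mathbf{m}:X\times X\to[0,\infty)$ be a function, and let $T:X\to X$ be an asymptotic $\mathbf{m}$-contraction. Let $x\in X$, put $x_n=T^nx$ ($n\in\mathbb{N}_0$), and suppose that $$\limsup_{n\to\infty}\mathbf{m}(x_{p_n},x_{q_n})\leq\limsup_{n\to\infty}d(x_{p_n},x_{q_n})$$ for any two subsequences $\{x_{p_n}\}$ and $\{x_{q_n}\}$ of $\{x_n\}$. Then $\{T^nx\}$ is a Cauchy sequence.
   Context: $\mathbb{N}=\{1,2,\dots\}$ and $\mathbb{N}_0=\mathbb{N}\cup\{0\}$; all sequences are indexed by $\mathbb{N}_0$. A subsequence $\{x_{p_n}\}$ is given by a strictly increasing sequence $\{p_n\}$ of nonnegative integers. Limits superior are taken in $[0,\infty]$. Definition. Let $T$ be a self-map of a metric space $X$ and $\mathbf{m}$ a nonnegative function on $X\times X$. $T$ is an asymptotic $\mathbf{m}$-contraction if (i) $d(T^nx,T^ny)\to 0$ for all $x,y\in X$; and (ii) for every $x\in X$ and $\epsilon>0$ there exist $\delta>0$, $\nu\in\mathbb{N}$ and $N\in\mathbb{N}_0$ such that, for all $p,q\geq N$, $\mathbf{m}(T^px,T^qx)<\epsilon+\delta$ implies $d(T^{p+\nu}x,T^{q+\nu}x)\leq\epsilon$. *)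

theory Defs
  imports "HOL-Analysis.Analysis"
begin

text \<open>The index \<open>\<nu>\<close> ranges over the positive integers, whereas \<open>N\<close> may be 0.
  Nonnegativity of \<open>m\<close> is not part of the predicate: \<open>m\<close> is meant to be a nonnegative
  function, which is assumed wherever it is introduced.\<close>

definition asymptotic_m_contraction ::
  "('a::metric_space \<Rightarrow> 'a \<Rightarrow> real) \<Rightarrow> ('a \<Rightarrow> 'a) \<Rightarrow> bool" where
  "asymptotic_m_contraction m T \<longleftrightarrow>
     (\<forall>x y. (\<lambda>n. dist ((T ^^ n) x) ((T ^^ n) y)) \<longlonglongrightarrow> 0) \<and>
     (\<forall>x. \<forall>\<epsilon>>0. \<exists>\<delta>>0. \<exists>\<nu>::nat. \<nu> \<ge> 1 \<and> (\<exists>N::nat. \<forall>p\<ge>N. \<forall>q\<ge>N.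
        m ((T ^^ p) x) ((T ^^ q) x) < \<epsilon> + \<delta> \<longrightarrow>
        dist ((T ^^ (p + \<nu>)) x) ((T ^^ (q + \<nu>)) x) \<le> \<epsilon>))"

end

(* The limsup hypothesis lets the contraction condition be read with d in place of m: otherwise
   there are indices p_n, q_n, increasing in n, with d(x_(p_n), x_(q_n)) < \<epsilon> + 1/(n+1) but
   m(x_(p_n), x_(q_n)) \<ge> \<epsilon> + \<delta>.  So d(x_p, x_q) < \<epsilon> + \<eta> implies d(x_(p+\<nu>), x_(q+\<nu>)) \<le> \<epsilon> for
   large p, q.  Condition (i) makes d(x_p, x_(p+i)) < \<eta> for i \<le> \<nu> and large p, and then induction
   on k in steps of \<nu> gives d(x_p, x_(p+k)) < \<epsilon> + \<eta>. *)
theory Submission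
  imports Defs
begin

text \<open>Along a sequence of counterexamples for \<eta> = 1/(n+1), the limsup of \<open>b\<close>
  is at most \<epsilon> while that of \<open>a\<close> is at least \<epsilon> + \<delta>. Signs of
  \<open>a\<close> and \<open>b\<close> do not matter, since \<open>ennreal\<close> is monotone and
  sends negative reals to 0.\<close>

lemma limsup_le_transfers_bound:
  fixes a b :: "nat \<Rightarrow> nat \<Rightarrow> real"
  assumes limsup_le: "\<And>p q :: nat \<Rightarrow> nat. strict_mono p \<Longrightarrow> strict_mono q \<Longrightarrow>
      limsup (\<lambda>n. ennreal (a (p n) (q n))) \<le> limsup (\<lambda>n. ennreal (b (p n) (q n)))"
    and "0 \<le> \<epsilon>" and "0 < \<delta>"
  shows "\<exists>\<eta>>0. \<exists>M. \<forall>p\<ge>M. \<forall>q\<ge>M. b p q < \<epsilon> + \<eta> \<longrightarrow> a p q < \<epsilon> + \<delta>"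
proof (rule ccontr)
  assume "\<not> ?thesis"
  then have ex: "\<exists>p q. M \<le> p \<and> M \<le> q \<and> b p q < \<epsilon> + \<eta> \<and> \<epsilon> + \<delta> \<le> a p q" if "0 < \<eta>" for \<eta> M
    using that by (meson not_less)
  define P where "P n r \<longleftrightarrow> b (fst r) (snd r) < \<epsilon> + inverse (real (Suc n)) \<and>
    \<epsilon> + \<delta> \<le> a (fst r) (snd r)" for n r
  have P_ex: "\<exists>r. P n r \<and> M \<le> fst r \<and> M \<le> snd r" for n M
    using ex[of "inverse (real (Suc n))" M] unfolding P_def by fastforce
  have "\<exists>f. \<forall>n. P n (f n) \<and> fst (f n) < fst (f (Suc n)) \<and> snd (f n) < snd (f (Suc n))"
  proof (rule dependent_nat_choice)
    show "\<exists>r. P 0 r"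
      using P_ex by blast
    show "\<exists>s. P (Suc n) s \<and> fst r < fst s \<and> snd r < snd s" for r n
      \<comment> \<open>Searching beyond the maximum of both previous indices makes both coordinates
        increase strictly, as \<open>limsup_le\<close> demands.\<close>
      using P_ex[of "Suc n" "Suc (max (fst r) (snd r))"] by (auto simp: Suc_le_eq)
  qed
  then obtain f where P: "\<And>n. P n (f n)"
    and inc: "\<And>n. fst (f n) < fst (f (Suc n)) \<and> snd (f n) < snd (f (Suc n))"
    by blast
  have "strict_mono (\<lambda>n. fst (f n))" "strict_mono (\<lambda>n. snd (f n))"
    using inc by (auto simp: strict_mono_Suc_iff)
  note le = limsup_le[OF this]
  have "(\<lambda>n. \<epsilon> + inverse (real (Suc n))) \<longlonglongrightarrow> \<epsilon>"
    using LIMSEQ_inverse_real_of_nat_add by simp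
  then have "limsup (\<lambda>n. ennreal (\<epsilon> + inverse (real (Suc n)))) = ennreal \<epsilon>"
    by (intro lim_imp_Limsup tendsto_ennrealI) auto
  moreover have "limsup (\<lambda>n. ennreal (b (fst (f n)) (snd (f n))))
      \<le> limsup (\<lambda>n. ennreal (\<epsilon> + inverse (real (Suc n))))"
    using P by (intro Limsup_mono always_eventually allI ennreal_leI) (auto simp: P_def less_imp_le)
  moreover have "ennreal (\<epsilon> + \<delta>) \<le> limsup (\<lambda>n. ennreal (a (fst (f n)) (snd (f n))))"
    using P by (intro le_Limsup always_eventually allI ennreal_leI) (auto simp: P_def)
  ultimately have "ennreal (\<epsilon> + \<delta>) \<le> ennreal \<epsilon>"
    using le by (metis order_trans)
  then show False
    using \<open>0 \<le> \<epsilon>\<close> \<open>0 < \<delta>\<close> by simp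
qed

text \<open>The point \<open>X (p + \<nu>)\<close> serves as a relay: it is \<eta>-close to
  \<open>X p\<close>, and \<open>shift\<close> at k - \<nu> puts it within \<epsilon> of
  \<open>X (p + k)\<close>. The base point \<open>p\<close> stays fixed, so the errors do not
  accumulate.\<close>

lemma dist_less_by_shift:
  fixes X :: "nat \<Rightarrow> 'a::metric_space"
  assumes "0 < \<nu>" and "0 \<le> \<epsilon>"
    and short: "\<And>i. i \<le> \<nu> \<Longrightarrow> dist (X p) (X (p + i)) < \<eta>"
    and shift: "\<And>k. dist (X p) (X (p + k)) < \<epsilon> + \<eta> \<Longrightarrow> dist (X (p + \<nu>)) (X (p + k + \<nu>)) \<le> \<epsilon>"
  shows "dist (X p) (X (p + k)) < \<epsilon> + \<eta>"
proof (induction k rule: less_induct)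
  case (less k)
  show ?case
  proof (cases "k \<le> \<nu>")
    case True
    then show ?thesis
      using short[of k] \<open>0 \<le> \<epsilon>\<close> by linarith
  next
    case False
    then have "dist (X (p + \<nu>)) (X (p + k)) \<le> \<epsilon>"
      using shift[of "k - \<nu>"] less[of "k - \<nu>"] \<open>0 < \<nu>\<close> by simp
    then show ?thesis
      using short[of \<nu>] dist_triangle[of "X p" "X (p + k)" "X (p + \<nu>)"] by simp
  qed
qed

theorem theorem4p4:
  fixes m :: "'a::metric_space \<Rightarrow> 'a \<Rightarrow> real"
    and T :: "'a \<Rightarrow> 'a"
    and x :: 'a
  assumes m_nonneg: "\<And>u v. 0 \<le> m u v"
    and contr: "asymptotic_m_contraction m T"
    and limsup_le: "\<And>p q :: nat \<Rightarrow> nat. strict_mono p \<Longrightarrow> strict_mono q \<Longrightarrow>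
      limsup (\<lambda>n. ennreal (m ((T ^^ p n) x) ((T ^^ q n) x)))
        \<le> limsup (\<lambda>n. ennreal (dist ((T ^^ p n) x) ((T ^^ q n) x)))"
  shows "Cauchy (\<lambda>n. (T ^^ n) x)"
proof (rule metric_CauchyI)
  fix e :: real
  assume "0 < e"
  define \<epsilon> where "\<epsilon> = e / 2"
  define X where "X n = (T ^^ n) x" for n
  have "0 < \<epsilon>"
    using \<open>0 < e\<close> by (simp add: \<epsilon>_def)
  obtain \<delta> \<nu> N where "0 < \<delta>" "0 < \<nu>"
    and contr_m: "\<And>p q. N \<le> p \<Longrightarrow> N \<le> q \<Longrightarrow> m (X p) (X q) < \<epsilon> + \<delta> \<Longrightarrow>
      dist (X (p + \<nu>)) (X (q + \<nu>)) \<le> \<epsilon>"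
  proof -
    from contr \<open>0 < \<epsilon>\<close> have "\<exists>\<delta>>0. \<exists>\<nu>::nat. \<nu> \<ge> 1 \<and> (\<exists>N::nat. \<forall>p\<ge>N. \<forall>q\<ge>N.
        m (X p) (X q) < \<epsilon> + \<delta> \<longrightarrow> dist (X (p + \<nu>)) (X (q + \<nu>)) \<le> \<epsilon>)"
      unfolding asymptotic_m_contraction_def X_def by blast
    then show thesis
      using that by (metis One_nat_def Suc_le_eq)
  qed
  obtain \<eta>' M where "0 < \<eta>'"
    and bound: "\<And>p q. M \<le> p \<Longrightarrow> M \<le> q \<Longrightarrow> dist (X p) (X q) < \<epsilon> + \<eta>' \<Longrightarrow> m (X p) (X q) < \<epsilon> + \<delta>"
    using limsup_le_transfers_bound[of "\<lambda>p q. m (X p) (X q)" "\<lambda>p q. dist (X p) (X q)" \<epsilon> \<delta>,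
        unfolded X_def, OF limsup_le less_imp_le[OF \<open>0 < \<epsilon>\<close>] \<open>0 < \<delta>\<close>]
    unfolding X_def by blast
  \<comment> \<open>The bound by \<eta>' keeps \<open>bound\<close> applicable; the bound by
    \<epsilon> = e/2 gives \<epsilon> + \<eta> \<le> e at the end.\<close>
  define \<eta> where "\<eta> = min \<eta>' \<epsilon>"
  have "0 < \<eta>"
    using \<open>0 < \<eta>'\<close> \<open>0 < \<epsilon>\<close> by (simp add: \<eta>_def)
  \<comment> \<open>Condition (i) for the points \<open>x\<close> and \<open>(T ^^ i) x\<close>,
    whose orbits differ by a shift of the index.\<close>
  have "(\<lambda>n. dist (X n) (X (n + i))) \<longlonglongrightarrow> 0" for i
    using contr by (simp add: asymptotic_m_contraction_def X_def funpow_add)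
  then have "\<forall>i\<in>{..\<nu>}. \<forall>\<^sub>F n in sequentially. dist (X n) (X (n + i)) < \<eta>"
    using \<open>0 < \<eta>\<close> by (auto dest: order_tendstoD(2))
  \<comment> \<open>Only finitely many \<open>i\<close> occur, so one threshold serves them
    all.\<close>
  then have "\<forall>\<^sub>F n in sequentially. \<forall>i\<in>{..\<nu>}. dist (X n) (X (n + i)) < \<eta>"
    by (intro eventually_ball_finite) auto
  then obtain L where L: "\<And>n i. L \<le> n \<Longrightarrow> i \<le> \<nu> \<Longrightarrow> dist (X n) (X (n + i)) < \<eta>"
    by (auto simp: eventually_sequentially)
  define K where "K = max L (max M N)"
  have tail: "dist (X p) (X (p + k)) < e" if "K \<le> p" for p k
  proof -
    have "dist (X p) (X (p + k)) < \<epsilon> + \<eta>"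
    proof (rule dist_less_by_shift)
      show "dist (X p) (X (p + i)) < \<eta>" if "i \<le> \<nu>" for i
        using L \<open>K \<le> p\<close> that by (simp add: K_def)
      \<comment> \<open>\<open>bound\<close> turns the distance estimate into one for
        \<open>m\<close>, to which \<open>contr_m\<close> applies; both indices are at least
        \<open>K\<close>.\<close>
      show "dist (X (p + \<nu>)) (X (p + k + \<nu>)) \<le> \<epsilon>" if "dist (X p) (X (p + k)) < \<epsilon> + \<eta>" for k
        using that \<open>K \<le> p\<close> by (intro contr_m bound) (auto simp: K_def \<eta>_def)
    qed (use \<open>0 < \<nu>\<close> \<open>0 < \<epsilon>\<close> in auto)
    then show ?thesis
      by (simp add: \<eta>_def \<epsilon>_def)
  qed
  \<comment> \<open>\<open>tail\<close> compares an index with a later one; symmetry of the distance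
    covers the other order.\<close>
  have "dist (X p) (X q) < e" if "K \<le> p" "K \<le> q" for p q
    using tail[of p "q - p"] tail[of q "p - q"] that
    by (cases "p \<le> q") (auto simp: dist_commute)
  then show "\<exists>M. \<forall>p\<ge>M. \<forall>q\<ge>M. dist ((T ^^ p) x) ((T ^^ q) x) < e"
    unfolding X_def by blast
qed

end
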